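(* For every integer $n\geq 3$, the $n\times n$ circulant matrix $\mathbb{P}=\mathrm{circ}(P_1,P_2,\ldots,P_n)$, where $P_k$ is the $k$th Pell number, is invertible.
   Context: The Pell numbers are defined by $P_0=0$, $P_1=1$, and $P_k=2P_{k-1}+P_{k-2}$ for $k\geq 2$. For numbers $c_0,c_1,\ldots,c_{n-1}$, $\mathrm{circ}(c_0,c_1,\ldots,c_{n-1})$ denotes the $n\times n$ circulant matrix whose first row is $(c_0,c_1,\ldots,c_{n-1})$ and in which each subsequent row is the cyclic shift of the previous row one position to the right; i.e. its $(i,j)$ entry is $c_{(j-i)\bmod n}$ for $1\le i,j\le n$. *)

theory Defs
  imports Complex_Main "Jordan_Normal_Form.Matrix"
begin

fun pell :: "nat \<Rightarrow> nat" where
  "pell 0 = 0"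
| "pell (Suc 0) = 1"
| "pell (Suc (Suc k)) = 2 * pell (Suc k) + pell k"

text \<open>Indices are 0-based, which leaves the difference \<open>j - i\<close> unchanged. It is taken
  in \<^typ>\<open>int\<close>, since \<^typ>\<open>nat\<close> subtraction truncates.\<close>

definition circ :: "'a vec \<Rightarrow> 'a mat" where
  "circ c = mat (dim_vec c) (dim_vec c)
     (\<lambda>(i, j). c $ nat ((int j - int i) mod int (dim_vec c)))"

end

theory Submission
  imports Defs "Jordan_Normal_Form.Determinant"
begin

text \<open>The Pell recurrence makes the combination \<open>R\<^sub>i - 2 R\<^sub>i\<^sub>+\<^sub>1 - R\<^sub>i\<^sub>+\<^sub>2\<close> of consecutive rows
  vanish except in the columns \<open>i\<close> and \<open>i + 1\<close> (mod \<open>n\<close>), where it is \<open>1 - P\<^sub>n\<^sub>+\<^sub>1\<close> and \<open>- P\<^sub>n\<close>.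
  So a kernel vector \<open>v\<close> satisfies \<open>(1 - P\<^sub>n\<^sub>+\<^sub>1) v\<^sub>i = P\<^sub>n v\<^sub>i\<^sub>+\<^sub>1\<close> cyclically. As \<open>P\<^sub>n\<^sub>+\<^sub>1 - 1 > P\<^sub>n\<close>,
  an entry of maximal modulus must be \<open>0\<close>.\<close>

lemma pell_pos: "0 < k \<Longrightarrow> 0 < pell k"
  by (induction k rule: pell.induct) auto

text \<open>The gap \<open>pell (n + 1) - pell n\<close> equals
  \<open>pell n + pell (n - 1)\<close>, a sum of two positive integers, hence at least 2. At
  \<open>n = 1\<close> the gap is only 1.\<close>

lemma pell_Suc_gt:
  assumes "2 \<le> n"
  shows "pell n + 1 < pell (Suc n)"
proof -
  obtain m where n: "n = Suc (Suc m)"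
    using assms by (metis Suc_le_D numeral_2_eq_2 Suc_le_mono)
  have "0 < pell (Suc m)" "0 < pell (Suc (Suc m))"
    by (rule pell_pos, simp)+
  then show ?thesis
    by (simp add: n)
qed

lemma mod_diff_1_nat:
  fixes d :: int and n :: nat
  assumes "2 \<le> n"
  shows "nat ((d - 1) mod int n) = (if nat (d mod int n) = 0 then n - 1 else nat (d mod int n) - 1)"
proof -
  have r: "0 \<le> d mod int n" "d mod int n < int n"
    using assms by auto
  have e: "(d - 1) mod int n = (d mod int n - 1) mod int n"
    by (simp add: mod_diff_left_eq)
  show ?thesis
  proof (cases "d mod int n = 0")
    case True
    have "(- 1) mod int n = int n - 1"
      using assms by (simp add: zmod_minus1)
    then show ?thesis
      unfolding e using True assms by simp
  next
    case False
    then have "(d mod int n - 1) mod int n = d mod int n - 1"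
      using r by (intro mod_pos_pos_trivial) auto
    then show ?thesis
      unfolding e using False r by (simp add: nat_diff_distrib)
  qed
qed

text \<open>\<open>f\<close> extends \<open>pell 1, ..., pell n\<close> to an
  \<open>n\<close>-periodic function on the integers, with \<open>pell 1\<close> at residue 0. The
  recurrence fails only where it wraps around: residue 0 gives
  \<open>1 - (2 * pell n + pell (n - 1))\<close>, residue 1 gives
  \<open>2 - 2 * 1 - pell n\<close>.\<close>

lemma periodic_pell_recurrence:
  fixes n :: nat and d :: int
  defines "f \<equiv> \<lambda>d :: int. real (pell (nat (d mod int n) + 1))"
  assumes n: "2 \<le> n"
  shows "f d - 2 * f (d - 1) - f (d - 2) =
    (if nat (d mod int n) = 0 then 1 - real (pell (n + 1))
     else if nat (d mod int n) = 1 then - real (pell n) else 0)"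
proof -
  define r where "r = nat (d mod int n)"
  have r1: "nat ((d - 1) mod int n) = (if r = 0 then n - 1 else r - 1)"
    unfolding r_def by (rule mod_diff_1_nat[OF n])
  \<comment> \<open>Two unit shifts; from residue 1 the second one wraps to
    \<open>n - 1\<close>.\<close>
  have r2: "nat ((d - 2) mod int n) =
      (if r = 0 then n - 2 else if r = 1 then n - 1 else r - 2)"
    using mod_diff_1_nat[OF n, of "d - 1"] n unfolding r1 by (auto simp: numeral_2_eq_2)
  obtain m where m: "n = Suc (Suc m)"
    using n by (metis Suc_le_D numeral_2_eq_2 Suc_le_mono)
  consider "r = 0" | "r = 1" | k where "r = Suc (Suc k)"
    by (metis One_nat_def not0_implies_Suc)
  then show ?thesis
    unfolding f_def r1 r2 r_def[symmetric] by cases (auto simp: m)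
qed

lemma invertible_matI_kernel:
  fixes A :: "'a :: field mat"
  assumes A: "A \<in> carrier_mat n n"
    and ker: "\<And>v. v \<in> carrier_vec n \<Longrightarrow> A *\<^sub>v v = 0\<^sub>v n \<Longrightarrow> v = 0\<^sub>v n"
  shows "invertible_mat A"
proof -
  have "det A \<noteq> 0"
    using det_0_iff_vec_prod_zero[OF A] ker by blast
  then obtain B where "B \<in> carrier_mat n n" "B * A = 1\<^sub>m n" "A * B = 1\<^sub>m n"
    using det_non_zero_imp_unit[OF A] A
    by (auto simp: Units_def ring_mat_def)
  then show ?thesis
    using A by (auto simp: invertible_mat_def inverts_mat_def)
qed

text \<open>Row \<open>k\<close> has entry \<open>f (j - k)\<close> in column \<open>j\<close>, so
  passing to the next row shifts the argument of \<open>f\<close> down by one, and the combined rows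
  have entries \<open>g (j - i)\<close>.\<close>

lemma pell_circ_kernel_step:
  fixes n i :: nat
  assumes n: "2 \<le> n" and v: "v \<in> carrier_vec n"
    and ker: "circ (vec n (\<lambda>k. real (pell (k + 1)))) *\<^sub>v v = 0\<^sub>v n" and i: "i < n"
  shows "(real (pell (n + 1)) - 1) * v $ i = - real (pell n) * v $ (Suc i mod n)"
proof -
  define f where "f d = real (pell (nat (d mod int n) + 1))" for d
  define g where "g d = f d - 2 * f (d - 1) - f (d - 2)" for d
  have row0: "(\<Sum>j<n. f (int j - int k) * v $ j) = 0" if "k < n" for k
  proof -
    have "(circ (vec n (\<lambda>k. real (pell (k + 1)))) *\<^sub>v v) $ k = (\<Sum>j<n. f (int j - int k) * v $ j)"
      using that v n
      by (auto simp: circ_def scalar_prod_def f_def atLeast0LessThan nat_less_iff intro!: sum.cong)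
    then show ?thesis
      using ker that by simp
  qed
  \<comment> \<open>Periodicity of \<open>f\<close> removes the bound on \<open>k\<close>, so that
    rows \<open>i + 1\<close> and \<open>i + 2\<close> may run past the last one.\<close>
  have row: "(\<Sum>j<n. f (int j - int k) * v $ j) = 0" for k
    using row0[of "k mod n"] n by (simp add: f_def zmod_int mod_diff_right_eq)
  have "(\<Sum>j<n. g (int j - int i) * v $ j) = (\<Sum>j<n. f (int j - int i) * v $ j)
      - 2 * (\<Sum>j<n. f (int j - int (i + 1)) * v $ j) - (\<Sum>j<n. f (int j - int (i + 2)) * v $ j)"
    by (simp add: g_def sum_subtractf sum.distrib sum_distrib_left algebra_simps)
  then have zero: "(\<Sum>j<n. g (int j - int i) * v $ j) = 0"
    by (simp only: row)
  define i' where "i' = Suc i mod n"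
  have i': "i' < n" "i' \<noteq> i"
    using n i by (auto simp: i'_def mod_Suc)
  have g: "g (int j - int i) = (if j = i then 1 - real (pell (n + 1))
      else if j = i' then - real (pell n) else 0)" if "j < n" for j
  proof -
    \<comment> \<open>This residue is 0 exactly for \<open>j = i\<close> and 1 exactly for
      \<open>j = i'\<close>; the second branch covers the wrap \<open>i = n - 1\<close>,
      \<open>j = 0\<close>.\<close>
    have "nat ((int j - int i) mod int n) = (if i \<le> j then j - i else n + j - i)"
    proof (cases "i \<le> j")
      case True
      then show ?thesis
        using that by (simp add: mod_pos_pos_trivial)
    next
      case False
      have "(int j - int i) mod int n = (int j - int i + int n) mod int n"
        by simp
      also have "\<dots> = int j - int i + int n"
        using False that i by (intro mod_pos_pos_trivial) auto
      finally show ?thesis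
        using False i by simp
    qed
    then show ?thesis
      unfolding g_def f_def periodic_pell_recurrence[OF n] i'_def
      using that i n by (auto simp: mod_Suc)
  qed
  have "(\<Sum>j<n. g (int j - int i) * v $ j) = (\<Sum>j\<in>{i, i'}. g (int j - int i) * v $ j)"
    using i i' by (intro sum.mono_neutral_right) (auto simp: g)
  also have "\<dots> = (1 - real (pell (n + 1))) * v $ i - real (pell n) * v $ i'"
    using i i' g[OF i] g[OF i'(1)] by simp
  finally show ?thesis
    using zero by (simp add: i'_def algebra_simps)
qed

theorem theorem3:
  fixes n :: nat
  assumes "n \<ge> 3"
  shows "invertible_mat (circ (vec n (\<lambda>k. real (pell (k + 1)))))"
proof (rule invertible_matI_kernel)
  show "circ (vec n (\<lambda>k. real (pell (k + 1)))) \<in> carrier_mat n n"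
    by (simp add: circ_def)
next
  fix v
  assume v: "v \<in> carrier_vec n"
    and ker: "circ (vec n (\<lambda>k. real (pell (k + 1)))) *\<^sub>v v = 0\<^sub>v n"
  have n: "2 \<le> n"
    using assms by simp
  obtain i where i: "i < n" and max: "\<And>j. j < n \<Longrightarrow> \<bar>v $ j\<bar> \<le> \<bar>v $ i\<bar>"
  proof -
    have ne: "(\<lambda>j. \<bar>v $ j\<bar>) ` {..<n} \<noteq> {}"
      using n by (auto simp: lessThan_empty_iff)
    have "Max ((\<lambda>j. \<bar>v $ j\<bar>) ` {..<n}) \<in> (\<lambda>j. \<bar>v $ j\<bar>) ` {..<n}"
      using ne by (intro Max_in) auto
    then obtain i where "i < n" "Max ((\<lambda>j. \<bar>v $ j\<bar>) ` {..<n}) = \<bar>v $ i\<bar>"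
      by auto
    then show ?thesis
      using that by (metis Max_ge finite_imageI finite_lessThan imageI lessThan_iff)
  qed
  have gt: "real (pell n) < real (pell (n + 1)) - 1"
    using pell_Suc_gt[OF n] by simp
  \<comment> \<open>By \<open>gt\<close> the left coefficient is positive, so absolute values only
    remove the minus sign on the right.\<close>
  have "(real (pell (n + 1)) - 1) * \<bar>v $ i\<bar> = real (pell n) * \<bar>v $ (Suc i mod n)\<bar>"
    using arg_cong[OF pell_circ_kernel_step[OF n v ker i], of abs] gt
    by (simp add: abs_mult)
  also have "\<dots> \<le> real (pell n) * \<bar>v $ i\<bar>"
    using n by (intro mult_left_mono max) auto
  finally have "(real (pell (n + 1)) - 1 - real (pell n)) * \<bar>v $ i\<bar> \<le> 0"
    by (simp add: algebra_simps)
  then have "\<bar>v $ i\<bar> = 0"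
    using gt by (simp add: mult_le_0_iff)
  then show "v = 0\<^sub>v n"
    using max v by (intro eq_vecI) force+
qed

end
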